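(* Let $u_0,u_1$ be weights in $\mathbb R^n$, $w_0,w_1$ weights in $\mathbb R^+$, and $0<p_0,p_1<\infty$. Then there is $C<\infty$ with $$\|M\chi_E\|_{\Lambda^{p_1,\infty}_{u_1}(w_1)}\le C\|\chi_E\|_{\Lambda^{p_0}_{u_0}(w_0)},\qquad E\subset\mathbb R^n\text{ measurable},$$ if and only if there is $C<\infty$ such that, for every finite family of cubes $(Q_j)_{j=1}^J$ and every family of measurable sets $(E_j)_{j=1}^J$ with $E_j\subset Q_j$ for every $j$, $$\frac{W_1^{1/p_1}\big(u_1\big(\bigcup_jQ_j\big)\big)}{W_0^{1/p_0}\big(u_0\big(\bigcup_jE_j\big)\big)}\le C\max_j\frac{|Q_j|}{|E_j|}.$$
   Context: $M$ is the Hardy–Littlewood maximal operator $Mf(x)=\sup_{x\in Q}\frac1{|Q|}\int_Q|f(y)|\,dy$, the supremum over all cubes $Q\ni x$ in $\mathbb R^n$ with sides parallel to the axes; all cubes are of this type. A weight $u$ in $\mathbb R^n$ is a nonnegative locally integrable function, not identically zero; $u(A)=\int_Au(x)\,dx$. Each weight $w_i$ in $\mathbb R^+=(0,\infty)$ is a nonnegative measurable function with $W_i(t)=\int_0^tw_i(s)\,ds<\infty$ for $t<\infty$, supported in $[0,u_i(\mathbb R^n)]$ and not identically zero. For a weight $u$ in $\mathbb R^n$ and a weight $w$ in $\mathbb R^+$ with $W(t)=\int_0^tw$: $\lambda^u_f(t)=u(\{|f|>t\})$, $f^*_u(t)=\inf\{s>0:\lambda^u_f(s)\le t\}$, $\|f\|_{\Lambda^p_u(w)}=\big(\int_0^\infty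 (f^*_u(t))^pw(t)\,dt\big)^{1/p}$, $\|f\|_{\Lambda^{p,\infty}_u(w)}=\sup_{t>0}W^{1/p}(t)f^*_u(t)=\sup_{t>0}t\,W^{1/p}(\lambda^u_f(t))$. Conventions: $0/0=\infty/\infty=0\cdot\infty=0$, $a/0=\infty$ for $a>0$. *)

theory Defs
  imports "HOL-Analysis.Analysis"
begin

(* All quantities that may be infinite live in ennreal. Its arithmetic already follows the
   conventions 0/0 = infinity/infinity = 0 * infinity = 0 and a/0 = infinity for a > 0. *)

(* Only used for exponents p > 0. *)
definition ennpowr :: "ennreal \<Rightarrow> real \<Rightarrow> ennreal" where
  "ennpowr x p = (if x = \<infinity> then \<infinity> else ennreal (enn2real x powr p))"

(* Cubes are taken open and nondegenerate. With closed cubes instead, the maximal function is the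
   same at every point for locally integrable f, and measures of cubes are the same because
   faces are null sets. *)
definition is_cube :: "(real ^ 'n) set \<Rightarrow> bool" where
  "is_cube Q \<longleftrightarrow> (\<exists>a l. 0 < l \<and> Q = {x. \<forall>i. a $ i < x $ i \<and> x $ i < a $ i + l})"

definition maximal :: "(real ^ 'n \<Rightarrow> real) \<Rightarrow> real ^ 'n \<Rightarrow> ennreal" where
  "maximal f x = (SUP Q \<in> {Q. is_cube Q \<and> x \<in> Q}.
     (\<integral>\<^sup>+y\<in>Q. ennreal \<bar>f y\<bar> \<partial>lebesgue) / emeasure lebesgue Q)"

(* "Not identically zero" is understood almost everywhere. *)
definition weight :: "(real ^ 'n \<Rightarrow> real) \<Rightarrow> bool" where
  "weight u \<longleftrightarrow> u \<in> borel_measurable lebesgue \<and> (\<forall>x. 0 \<le> u x) \<and>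
     (\<forall>K. compact K \<longrightarrow> u absolutely_integrable_on K) \<and>
     \<not> (AE x in lebesgue. u x = 0)"

definition wmeas :: "(real ^ 'n \<Rightarrow> real) \<Rightarrow> (real ^ 'n) set \<Rightarrow> ennreal" where
  "wmeas u A = (\<integral>\<^sup>+x\<in>A. ennreal (u x) \<partial>lebesgue)"

(* The upper limit t may be infinity, since it is used with t = u(A). *)
definition primitive :: "(real \<Rightarrow> real) \<Rightarrow> ennreal \<Rightarrow> ennreal" where
  "primitive w t = (\<integral>\<^sup>+s\<in>{s. 0 < s \<and> ennreal s < t}. ennreal (w s) \<partial>lebesgue)"

(* w is a function on the half-line (0, infinity), so its values on the rest of the line are
   irrelevant; it is supported in [0, u(R^n)] and nonzero in the almost-everywhere sense. *)
definition half_line_weight :: "(real ^ 'n \<Rightarrow> real) \<Rightarrow> (real \<Rightarrow> real) \<Rightarrow> bool" where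
  "half_line_weight u w \<longleftrightarrow> w \<in> borel_measurable (lebesgue_on {0<..}) \<and> (\<forall>s>0. 0 \<le> w s) \<and>
     (\<forall>t<\<infinity>. primitive w t < \<infinity>) \<and>
     (AE s in lebesgue_on {0<..}. wmeas u UNIV < ennreal s \<longrightarrow> w s = 0) \<and>
     \<not> (AE s in lebesgue_on {0<..}. w s = 0)"

(* The distribution function, the rearrangement and the Lorentz functionals depend on a function
   only through its absolute value; the argument f below is that absolute value, which may
   be infinite. *)
definition distr_fun :: "(real ^ 'n \<Rightarrow> real) \<Rightarrow> (real ^ 'n \<Rightarrow> ennreal) \<Rightarrow> ennreal \<Rightarrow> ennreal" where
  "distr_fun u f s = wmeas u {x. s < f x}"

definition rearrangement :: "(real ^ 'n \<Rightarrow> real) \<Rightarrow> (real ^ 'n \<Rightarrow> ennreal) \<Rightarrow> ennreal \<Rightarrow> ennreal" where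
  "rearrangement u f t = Inf {s. 0 < s \<and> distr_fun u f s \<le> t}"

definition lorentz_norm ::
  "real \<Rightarrow> (real ^ 'n \<Rightarrow> real) \<Rightarrow> (real \<Rightarrow> real) \<Rightarrow> (real ^ 'n \<Rightarrow> ennreal) \<Rightarrow> ennreal" where
  "lorentz_norm p u w f =
     ennpowr (\<integral>\<^sup>+t\<in>{0<..}. ennpowr (rearrangement u f (ennreal t)) p * ennreal (w t) \<partial>lebesgue) (1 / p)"

definition weak_lorentz_norm ::
  "real \<Rightarrow> (real ^ 'n \<Rightarrow> real) \<Rightarrow> (real \<Rightarrow> real) \<Rightarrow> (real ^ 'n \<Rightarrow> ennreal) \<Rightarrow> ennreal" where
  "weak_lorentz_norm p u w f =
     (SUP t\<in>{0<..}. ennpowr (primitive w (ennreal t)) (1 / p) * rearrangement u f (ennreal t))"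

end

theory Submission
  imports Defs
begin

text \<open>Since \<open>\<parallel>\<chi>\<^sub>E\<parallel>\<close> in \<open>\<Lambda>\<^sup>p\<^sub>u(w)\<close> equals \<open>W(u(E))\<^sup>1\<^sup>/\<^sup>p\<close>, both conditions compare values of \<open>W\<^sub>1\<close> and \<open>W\<^sub>0\<close>.
  If \<open>E\<^sub>j \<subseteq> Q\<^sub>j\<close>, then the maximal function of \<open>\<Union>\<^sub>j E\<^sub>j\<close> is at least \<open>min\<^sub>j |E\<^sub>j|/|Q\<^sub>j|\<close> on \<open>\<Union>\<^sub>j Q\<^sub>j\<close>, and
  left continuity of \<open>W\<^sub>1\<close> yields the covering inequality. Conversely, the superlevel set
  \<open>{M\<chi>\<^sub>E > s}\<close> is the union of the open cubes \<open>Q\<close> with \<open>|E \<inter> Q| > s|Q|\<close>; by Lindelof's theorem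
  finitely many of them carry any prescribed smaller amount of \<open>u\<^sub>1\<close>-mass, and the covering
  inequality is applied to these cubes with \<open>E\<^sub>j = E \<inter> Q\<^sub>j\<close>.\<close>

section \<open>Arithmetic and powers in the extended half-line; finite subfamilies\<close>

lemma ennreal_divide_leI: "a / b \<le> c" if "a \<le> c * b" for a b c :: ennreal
proof (cases "b = 0 \<or> b = \<infinity>")
  \<comment> \<open>\<open>b = 0\<close> forces \<open>a = 0\<close>, and \<open>0 / 0 = 0\<close>;
    division by infinity always gives \<open>0\<close>.\<close>
  case True
  then show ?thesis using that by (auto simp: ennreal_divide_top)
next
  case False
  then show ?thesis using that
    by (metis divide_le_posI_ennreal infinity_ennreal_def mult.commute not_gr_zero)
qed

text \<open>Finiteness matters: \<open>c < \<infinity>\<close> rules out a positive \<open>a\<close>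
  over \<open>b = 0\<close>, and for \<open>b = \<infinity>\<close>, \<open>c = 0\<close> the
  quotient would be \<open>0\<close> whatever \<open>a\<close> is.\<close>

lemma ennreal_le_of_divide_le: "a \<le> c * b"
  if "a / b \<le> c" "c < \<infinity>" "b < \<infinity>" for a b c :: ennreal
proof (cases "b = 0")
  case True
  with that have "a = 0" by (cases "a = 0") (auto simp: ennreal_divide_zero top_unique)
  then show ?thesis by simp
next
  case False
  have "a = a / b * b"
    using False that(3) by (simp add: ennreal_divide_times ennreal_divide_self)
  also have "\<dots> \<le> c * b" by (intro mult_right_mono that) auto
  finally show ?thesis .
qed

lemma ennreal_inverse_mult_self: "1 / s * s = 1" if "0 < s" "s < \<infinity>" for s :: ennreal
  using that by (simp add: ennreal_divide_times ennreal_divide_self)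

lemma ennpowr_mono: "ennpowr x p \<le> ennpowr y p" if "x \<le> y" "0 < p"
  using that unfolding ennpowr_def
  by (auto simp: top_unique less_top intro!: ennreal_leI powr_mono2 enn2real_mono)

lemma ennpowr_ennpowr_inverse: "ennpowr (ennpowr x p) (1 / p) = x" if "0 < p"
  using that by (cases x) (auto simp: ennpowr_def powr_powr)

lemma ennpowr_less_top: "ennpowr x p < \<infinity>" if "x < \<infinity>"
  using that by (auto simp: ennpowr_def)

text \<open>The powers \<open>p\<close> and \<open>1 / p\<close> are monotone and mutually inverse.
  This turns bounds on powers of primitives into bounds on the primitives themselves, to which left
  continuity applies.\<close>

lemma ennpowr_inverse_le_iff: "ennpowr x (1 / p) \<le> y \<longleftrightarrow> x \<le> ennpowr y p" if "0 < p"
proof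
  assume "ennpowr x (1 / p) \<le> y"
  from ennpowr_mono[OF this that] show "x \<le> ennpowr y p"
    using ennpowr_ennpowr_inverse[of "1 / p" x] that by simp
next
  assume "x \<le> ennpowr y p"
  from ennpowr_mono[OF this, of "1 / p"] show "ennpowr x (1 / p) \<le> y"
    using ennpowr_ennpowr_inverse[of p y] that by simp
qed

text \<open>Continuity from below along the finite unions of an enumeration of \<open>F\<close>. It
  serves twice: for intervals on the half-line and for cubes.\<close>

lemma less_emeasure_Union_finite_subfamily:
  assumes "countable F" "F \<subseteq> sets M" "t < emeasure M (\<Union>F)"
  obtains G where "finite G" "G \<subseteq> F" "t < emeasure M (\<Union>G)"
proof -
  have "F \<noteq> {}" using assms(3) by auto
  then have ran: "range (from_nat_into F) = F" using assms(1) by simp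
  define B where "B n = (\<Union>i\<le>n. from_nat_into F i)" for n
  have "range B \<subseteq> sets M" using assms(2) ran unfolding B_def by blast
  moreover have "incseq B" unfolding B_def by (fastforce intro!: incseq_SucI)
  ultimately have "(SUP n. emeasure M (B n)) = emeasure M (\<Union>n. B n)"
    by (rule SUP_emeasure_incseq)
  moreover have "(\<Union>n. B n) = \<Union>(range (from_nat_into F))" by (auto simp: B_def)
  ultimately obtain n where "t < emeasure M (B n)"
    using assms(3) ran by (metis less_SUP_iff)
  then show thesis
    using that[of "from_nat_into F ` {..n}"] ran unfolding B_def by blast
qed

section \<open>Primitives of weights on the half-line\<close>

lemma primitive_mono: "primitive w s \<le> primitive w t" if "s \<le> t"
  unfolding primitive_def using that
  by (intro nn_integral_mono) (auto split: split_indicator dest: less_le_trans)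

lemma sets_half_line_less: "{s::real. 0 < s \<and> ennreal s < t} \<in> sets lebesgue"
proof -
  have "{s::real. 0 < s \<and> ennreal s < t} \<in> sets borel" by measurable
  then show ?thesis by simp
qed

text \<open>Makes continuity from below available for \<open>primitive w\<close>. The indicator
  removes the values of \<open>w\<close> off the half-line, where measurability is not
  assumed.\<close>

lemma primitive_eq_emeasure:
  assumes "w \<in> borel_measurable (lebesgue_on {0<..})"
  shows "primitive w t =
    emeasure (density lebesgue (\<lambda>s. ennreal (indicator {0<..} s * w s))) {s. 0 < s \<and> ennreal s < t}"
proof -
  have "(\<lambda>s. indicator {0<..} s *\<^sub>R w s) \<in> borel_measurable lebesgue"
    using assms by (subst (asm) borel_measurable_restrict_space_iff) auto
  then have "(\<lambda>s. ennreal (indicator {0<..} s * w s)) \<in> borel_measurable lebesgue"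
    by simp
  moreover have "{s::real. 0 < s \<and> ennreal s < t} \<in> sets lebesgue"
    by (rule sets_half_line_less)
  ultimately show ?thesis
    unfolding primitive_def
    by (subst emeasure_density) (auto intro!: nn_integral_cong split: split_indicator)
qed

text \<open>Left continuity of \<open>primitive w\<close> at \<open>a\<close>, finite or infinite.
  It carries bounds at real \<open>t < u(A)\<close> over to \<open>u(A)\<close> itself.\<close>

lemma primitive_leI_of_less:
  assumes "w \<in> borel_measurable (lebesgue_on {0<..})"
    and bound: "\<And>t. 0 < t \<Longrightarrow> ennreal t < a \<Longrightarrow> primitive w (ennreal t) \<le> K"
  shows "primitive w a \<le> K"
proof (rule ccontr)
  let ?\<mu> = "density lebesgue (\<lambda>s. ennreal (indicator {0<..} s * w s))"
  \<comment> \<open>Rational endpoints make the exhausting family countable.\<close>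
  let ?F = "(\<lambda>q. {0<..<q}) ` {q \<in> \<rat>. 0 < q \<and> ennreal q < a}"
  assume "\<not> primitive w a \<le> K"
  then have "K < emeasure ?\<mu> {s. 0 < s \<and> ennreal s < a}"
    using primitive_eq_emeasure[OF assms(1)] by (simp add: not_le)
  also have "{s. 0 < s \<and> ennreal s < a} = \<Union>?F"
  proof (intro equalityI subsetI)
    fix s assume s: "s \<in> {s. 0 < s \<and> ennreal s < a}"
    \<comment> \<open>Being below \<open>a\<close>, the intermediate \<open>c\<close> is finite even
      when \<open>a\<close> is not, so a rational can be chosen between \<open>s\<close> and
      \<open>c\<close>.\<close>
    obtain c where c: "ennreal s < c" "c < a" using s dense by blast
    then have "s < enn2real c"
      using s by (cases c) (auto simp: ennreal_less_iff)
    then obtain q where q: "q \<in> \<rat>" "s < q" "q < enn2real c" using Rats_dense_in_real by blast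
    have "ennreal q < c"
      using q s c by (cases c) (auto simp: ennreal_less_iff)
    then show "s \<in> \<Union>?F" using q s c by (intro UnionI[of "{0<..<q}"]) auto
  next
    fix s assume "s \<in> \<Union>?F"
    then obtain q where "0 < s" "s < q" "ennreal q < a" by auto
    then show "s \<in> {s. 0 < s \<and> ennreal s < a}"
      by (auto intro: le_less_trans[of "ennreal s" "ennreal q" a] ennreal_leI)
  qed
  finally obtain G where G: "finite G" "G \<subseteq> ?F" "K < emeasure ?\<mu> (\<Union>G)"
    by (rule less_emeasure_Union_finite_subfamily[rotated 2])
       (auto intro: countable_subset[OF _ countable_rat])
  then obtain S where S: "finite S" "S \<subseteq> {q \<in> \<rat>. 0 < q \<and> ennreal q < a}"
    "G = (\<lambda>q. {0<..<q}) ` S" by (meson finite_subset_image)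
  \<comment> \<open>An empty union has mass \<open>0\<close>, which cannot exceed \<open>K\<close>.
    Since the intervals are nested, the union of \<open>G\<close> is governed by the largest
    endpoint.\<close>
  have "S \<noteq> {}" using S G by auto
  then have "Max S \<in> S" using S by auto
  have "emeasure ?\<mu> (\<Union>G) \<le> emeasure ?\<mu> {s. 0 < s \<and> ennreal s < ennreal (Max S)}"
  proof (rule emeasure_mono)
    show "\<Union>G \<subseteq> {s. 0 < s \<and> ennreal s < ennreal (Max S)}"
      using S by (auto simp: ennreal_less_iff intro: less_le_trans[OF _ Max_ge])
  qed (simp add: sets_half_line_less)
  also have "\<dots> \<le> K"
    using bound[of "Max S"] \<open>Max S \<in> S\<close> S primitive_eq_emeasure[OF assms(1)] by auto
  finally show False using G by simp
qed

section \<open>Weighted measures and cubes\<close>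

lemma wmeas_eq_emeasure:
  "wmeas u A = emeasure (density lebesgue (\<lambda>x. ennreal (u x))) A"
  if "u \<in> borel_measurable lebesgue" "A \<in> sets lebesgue"
  using that by (simp add: wmeas_def emeasure_density)

lemma wmeas_mono: "wmeas u A \<le> wmeas u B" if "A \<subseteq> B"
  unfolding wmeas_def using that by (intro nn_integral_mono) (auto split: split_indicator)

text \<open>Local integrability is applied to the compact closure of \<open>A\<close>. The result
  later keeps the denominator of the covering inequality finite.\<close>

lemma wmeas_bounded_less_top: "wmeas u A < \<infinity>" if "weight u" "bounded A"
proof -
  have nonneg: "0 \<le> u x" for x using \<open>weight u\<close> by (simp add: weight_def)
  have "compact (closure A)" using \<open>bounded A\<close> by (simp add: compact_closure)
  then have "integrable lebesgue (\<lambda>x. indicator (closure A) x *\<^sub>R u x)"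
    using \<open>weight u\<close> by (auto simp: weight_def set_integrable_def)
  then have "(\<integral>\<^sup>+x. ennreal (norm (indicator (closure A) x *\<^sub>R u x)) \<partial>lebesgue) < \<infinity>"
    by (simp add: integrable_iff_bounded)
  also have "(\<integral>\<^sup>+x. ennreal (norm (indicator (closure A) x *\<^sub>R u x)) \<partial>lebesgue) = wmeas u (closure A)"
    unfolding wmeas_def using nonneg by (intro nn_integral_cong) (auto split: split_indicator)
  finally show ?thesis using wmeas_mono[OF closure_subset] by (rule le_less_trans[rotated])
qed

lemma is_cube_eq_box:
  assumes "is_cube Q"
  obtains a l where "0 < l" "Q = box a (a + (\<chi> i. l))"
proof -
  obtain a l where "0 < l" "Q = {x. \<forall>i. a $ i < x $ i \<and> x $ i < a $ i + l}"
    using assms unfolding is_cube_def by blast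
  then show thesis by (intro that[of l a]) (auto simp: mem_box_cart)
qed

lemma
  assumes "is_cube Q"
  shows open_cube: "open Q" and bounded_cube: "bounded Q" and sets_cube: "Q \<in> sets lebesgue"
    and emeasure_cube_less_top: "emeasure lebesgue Q < \<infinity>"
proof -
  obtain a l where Q: "Q = box a (a + (\<chi> i. l))" using is_cube_eq_box[OF assms] by metis
  show "open Q" "bounded Q" "Q \<in> sets lebesgue" unfolding Q by (simp_all add: open_box bounded_box)
  show "emeasure lebesgue Q < \<infinity>"
    using lmeasurable_box unfolding Q by (metis fmeasurableD2 infinity_ennreal_def top.not_eq_extremum)
qed

lemma emeasure_cube_pos: "0 < emeasure lebesgue Q" if "is_cube Q"
proof -
  obtain a l where *: "0 < l" "Q = box a (a + (\<chi> i. l))" using is_cube_eq_box[OF \<open>is_cube Q\<close>] .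
  then have "a + (\<chi> i. l / 2) \<in> Q" by (simp add: mem_box_cart)
  then have "Q \<noteq> {}" by auto
  then have "\<not> negligible Q" using open_not_negligible open_cube[OF that] by blast
  then show ?thesis
    using sets_cube[OF that] by (auto simp: negligible_iff_null_sets null_sets_def zero_less_iff_neq_zero)
qed

section \<open>Maximal functions, rearrangements and Lorentz functionals of indicators\<close>

lemma maximal_indicator:
  assumes "E \<in> sets lebesgue"
  shows "maximal (indicator E) x =
    (SUP Q \<in> {Q. is_cube Q \<and> x \<in> Q}. emeasure lebesgue (E \<inter> Q) / emeasure lebesgue Q)"
proof -
  have "(\<integral>\<^sup>+y\<in>Q. ennreal \<bar>indicator E y\<bar> \<partial>lebesgue) = emeasure lebesgue (E \<inter> Q)"
    if "is_cube Q" for Q :: "(real ^ 'a) set"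
  proof -
    have "(\<integral>\<^sup>+y\<in>Q. ennreal \<bar>indicator E y\<bar> \<partial>lebesgue) = (\<integral>\<^sup>+y. indicator (E \<inter> Q) y \<partial>lebesgue)"
      by (intro nn_integral_cong) (auto split: split_indicator)
    then show ?thesis using assms sets_cube[OF that] by simp
  qed
  then show ?thesis unfolding maximal_def by (intro SUP_cong) auto
qed

text \<open>The average over \<open>Q\<close> is the same for all points of \<open>Q\<close>, so a
  cube that certifies the level at one point certifies it on all of \<open>Q\<close>.\<close>

lemma superlevel_maximal_indicator:
  assumes "E \<in> sets lebesgue"
  shows "{x. s < maximal (indicator E) x} =
    \<Union>{Q. is_cube Q \<and> s < emeasure lebesgue (E \<inter> Q) / emeasure lebesgue Q}"
  by (auto simp: maximal_indicator[OF assms] less_SUP_iff)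

lemma less_distr_fun: "t < distr_fun u f s" if "s < rearrangement u f t" "0 < s"
  using that unfolding rearrangement_def by (metis (mono_tags, lifting) Inf_lower leD mem_Collect_eq not_le)

lemma rearrangement_indicator:
  "rearrangement u (indicator E) t = (if t < wmeas u E then 1 else 0)"
proof -
  have d: "distr_fun u (indicator E) s = (if s < 1 then wmeas u E else 0)" for s
  proof -
    have "{x. s < indicator E x} = (if s < 1 then E else {})"
      by (auto split: split_indicator)
    then show ?thesis by (simp add: distr_fun_def wmeas_def)
  qed
  show ?thesis
  proof (cases "t < wmeas u E")
    case True
    then have "{s. 0 < s \<and> distr_fun u (indicator E) s \<le> t} = {1..}"
      by (auto simp: d not_less not_le intro: less_le_trans[OF zero_less_one])
    then show ?thesis using True by (simp add: rearrangement_def)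
  next
    case False
    then have "{s. 0 < s \<and> distr_fun u (indicator E) s \<le> t} = {0<..}"
      by (auto simp: d)
    then show ?thesis using False by (simp add: rearrangement_def)
  qed
qed

text \<open>The rearrangement takes only the values \<open>0\<close> and \<open>1\<close>, so its
  power leaves it unchanged and merely cuts the integral off at \<open>u(E)\<close>.\<close>

lemma lorentz_norm_indicator:
  "lorentz_norm p u w (indicator E) = ennpowr (primitive w (wmeas u E)) (1 / p)"
proof -
  have "ennpowr 0 p = 0" "ennpowr 1 p = 1" by (auto simp: ennpowr_def)
  then have "(\<integral>\<^sup>+t\<in>{0<..}. ennpowr (rearrangement u (indicator E) (ennreal t)) p * ennreal (w t) \<partial>lebesgue)
     = primitive w (wmeas u E)"
    unfolding primitive_def
    by (intro nn_integral_cong) (auto simp: rearrangement_indicator split: split_indicator)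
  then show ?thesis by (simp add: lorentz_norm_def)
qed

text \<open>A Chebyshev inequality. For \<open>t < u(A)\<close>, every level \<open>s < r\<close>
  has \<open>A\<close> inside \<open>{f > s}\<close>, hence distribution function above
  \<open>t\<close>; so the rearrangement at \<open>t\<close> is at least \<open>r\<close>. Left
  continuity of the primitive then reaches \<open>u(A)\<close>.\<close>

lemma primitive_wmeas_le_weak_lorentz_norm:
  assumes w: "w \<in> borel_measurable (lebesgue_on {0<..})" and p: "0 < p"
    and A: "\<And>x. x \<in> A \<Longrightarrow> r \<le> f x" and r: "0 < r" "r < \<infinity>"
  shows "ennpowr (primitive w (wmeas u A)) (1 / p) \<le> weak_lorentz_norm p u w f / r"
proof -
  have "primitive w (ennreal t) \<le> ennpowr (weak_lorentz_norm p u w f / r) p"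
    if t: "0 < t" "ennreal t < wmeas u A" for t
  proof -
    have "r \<le> rearrangement u f (ennreal t)"
      unfolding rearrangement_def
    proof (rule Inf_greatest, rule ccontr)
      fix s assume s: "s \<in> {s. 0 < s \<and> distr_fun u f s \<le> ennreal t}" "\<not> r \<le> s"
      then have "A \<subseteq> {x. s < f x}" using A by (auto simp: not_le intro: less_le_trans)
      then have "wmeas u A \<le> distr_fun u f s" unfolding distr_fun_def by (rule wmeas_mono)
      then show False using s t by auto
    qed
    then have "ennpowr (primitive w (ennreal t)) (1 / p) * r
        \<le> ennpowr (primitive w (ennreal t)) (1 / p) * rearrangement u f (ennreal t)"
      by (rule mult_left_mono) simp
    also have "\<dots> \<le> weak_lorentz_norm p u w f"
      unfolding weak_lorentz_norm_def using t by (intro SUP_upper) auto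
    finally have "ennpowr (primitive w (ennreal t)) (1 / p) * r / r \<le> weak_lorentz_norm p u w f / r"
      by (rule divide_right_mono_ennreal)
    then have "ennpowr (primitive w (ennreal t)) (1 / p) \<le> weak_lorentz_norm p u w f / r"
      using r by (simp add: ennreal_times_divide[symmetric] ennreal_divide_self)
    then show ?thesis using p by (simp add: ennpowr_inverse_le_iff)
  qed
  then show ?thesis using primitive_leI_of_less[OF w] p by (simp add: ennpowr_inverse_le_iff)
qed

section \<open>The two implications\<close>

lemma covering_inequality_of_weak_type:
  fixes Q E :: "nat \<Rightarrow> (real ^ 'n) set"
  assumes w1: "w1 \<in> borel_measurable (lebesgue_on {0<..})" and p1: "0 < p1"
    and weak: "\<And>E. E \<in> sets lebesgue \<Longrightarrow>
      weak_lorentz_norm p1 u1 w1 (maximal (indicator E)) \<le> C * lorentz_norm p0 u0 w0 (indicator E)"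
    and J: "1 \<le> J"
    and QE: "\<And>j. j \<in> {1..J} \<Longrightarrow> is_cube (Q j) \<and> E j \<in> sets lebesgue \<and> E j \<subseteq> Q j"
  shows "ennpowr (primitive w1 (wmeas u1 (\<Union>j\<in>{1..J}. Q j))) (1 / p1) /
         ennpowr (primitive w0 (wmeas u0 (\<Union>j\<in>{1..J}. E j))) (1 / p0)
         \<le> (C + 1) * Max ((\<lambda>j. emeasure lebesgue (Q j) / emeasure lebesgue (E j)) ` {1..J})"
proof -
  define R where "R = Max ((\<lambda>j. emeasure lebesgue (Q j) / emeasure lebesgue (E j)) ` {1..J})"
  have R: "emeasure lebesgue (Q j) / emeasure lebesgue (E j) \<le> R" if "j \<in> {1..J}" for j
    unfolding R_def using that by (intro Max_ge) auto
  show ?thesis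
  proof (cases "R = \<infinity>")
    \<comment> \<open>Here some \<open>E j\<close> is null. The constant \<open>C + 1\<close> is
      positive, so the right side is infinite; with \<open>C = 0\<close> it would be
      \<open>0 * \<infinity> = 0\<close>.\<close>
    case True
    then show ?thesis unfolding R_def[symmetric] by (simp add: ennreal_mult_top)
  next
    case False
    have Q: "0 < emeasure lebesgue (Q j)" "emeasure lebesgue (Q j) < \<infinity>"
      and E: "emeasure lebesgue (E j) \<le> emeasure lebesgue (Q j)" if "j \<in> {1..J}" for j
      using QE[OF that] emeasure_cube_pos emeasure_cube_less_top emeasure_mono[OF _ sets_cube]
      by blast+
    have Q_le: "emeasure lebesgue (Q j) \<le> R * emeasure lebesgue (E j)" if "j \<in> {1..J}" for j
      using that R[OF that] False Q[OF that] E[OF that]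
      by (intro ennreal_le_of_divide_le) (auto simp: less_top)
    \<comment> \<open>With \<open>R\<close> finite as well, \<open>1 / R\<close> is a positive
      finite level, as the Chebyshev inequality requires.\<close>
    have "R \<noteq> 0" using Q_le[of 1] Q[of 1] J by auto
    let ?E = "\<Union>j\<in>{1..J}. E j"
    have measE: "?E \<in> sets lebesgue" using QE by auto
    \<comment> \<open>At each of its points \<open>Q j\<close> itself competes in the supremum, and
      it contains the part \<open>E j\<close> of the union.\<close>
    have "1 / R \<le> maximal (indicator ?E) x" if x: "x \<in> (\<Union>j\<in>{1..J}. Q j)" for x
    proof -
      obtain j where j: "j \<in> {1..J}" "x \<in> Q j" using x by auto
      have "emeasure lebesgue (Q j) / R \<le> emeasure lebesgue (E j)"
        using Q_le[OF j(1)] by (intro ennreal_divide_leI) (simp add: mult.commute)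
      then have "emeasure lebesgue (Q j) / R / emeasure lebesgue (Q j)
          \<le> emeasure lebesgue (E j) / emeasure lebesgue (Q j)"
        by (rule divide_right_mono_ennreal)
      moreover have "emeasure lebesgue (Q j) / R / emeasure lebesgue (Q j) = 1 / R"
        using Q[OF j(1)] ennreal_divide_self[of "emeasure lebesgue (Q j)"]
        by (simp add: divide_ennreal_def mult_ac)
      ultimately have "1 / R \<le> emeasure lebesgue (E j) / emeasure lebesgue (Q j)" by simp
      also have "emeasure lebesgue (E j) / emeasure lebesgue (Q j)
          \<le> emeasure lebesgue (?E \<inter> Q j) / emeasure lebesgue (Q j)"
        using j QE measE sets_cube
        by (intro divide_right_mono_ennreal emeasure_mono sets.Int) auto
      also have "\<dots> \<le> maximal (indicator ?E) x"
        unfolding maximal_indicator[OF measE] using j QE by (intro SUP_upper) auto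
      finally show ?thesis .
    qed
    then have "ennpowr (primitive w1 (wmeas u1 (\<Union>j\<in>{1..J}. Q j))) (1 / p1)
        \<le> weak_lorentz_norm p1 u1 w1 (maximal (indicator ?E)) / (1 / R)"
      using \<open>R \<noteq> 0\<close> False
      by (intro primitive_wmeas_le_weak_lorentz_norm w1 p1) (auto simp: ennreal_zero_less_divide less_top[symmetric] ennreal_divide_eq_top_iff)
    also have "\<dots> = weak_lorentz_norm p1 u1 w1 (maximal (indicator ?E)) * R"
      using \<open>R \<noteq> 0\<close> False by (cases R) (auto simp: divide_ennreal_def inverse_ennreal)
    also have "\<dots> \<le> C * lorentz_norm p0 u0 w0 (indicator ?E) * R"
      by (intro mult_right_mono weak measE) auto
    also have "\<dots> \<le> (C + 1) * lorentz_norm p0 u0 w0 (indicator ?E) * R"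
      by (intro mult_right_mono) auto
    finally show ?thesis
      unfolding R_def[symmetric] lorentz_norm_indicator
      by (intro ennreal_divide_leI) (simp add: mult_ac)
  qed
qed

text \<open>The weak functional is tested level by level, and each level needs only finitely many
  cubes. Finiteness of \<open>C\<close> and of \<open>primitive w0\<close> at finite arguments
  allows the quotient in \<open>cover\<close> to be multiplied out.\<close>

lemma weak_type_of_covering_inequality:
  fixes E :: "(real ^ 'n) set"
  assumes u0: "weight u0" and u1: "weight u1"
    and w0: "\<And>t. t < \<infinity> \<Longrightarrow> primitive w0 t < \<infinity>"
    and p0: "0 < p0" and p1: "0 < p1" and C: "C < \<infinity>"
    and cover: "\<And>(J::nat) (Q :: nat \<Rightarrow> (real ^ 'n) set) E. 1 \<le> J \<Longrightarrow>
      (\<forall>j\<in>{1..J}. is_cube (Q j) \<and> E j \<in> sets lebesgue \<and> E j \<subseteq> Q j) \<Longrightarrow>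
      ennpowr (primitive w1 (wmeas u1 (\<Union>j\<in>{1..J}. Q j))) (1 / p1) /
      ennpowr (primitive w0 (wmeas u0 (\<Union>j\<in>{1..J}. E j))) (1 / p0)
      \<le> C * Max ((\<lambda>j. emeasure lebesgue (Q j) / emeasure lebesgue (E j)) ` {1..J})"
    and E: "E \<in> sets lebesgue"
  shows "weak_lorentz_norm p1 u1 w1 (maximal (indicator E)) \<le> C * lorentz_norm p0 u0 w0 (indicator E)"
proof -
  let ?B = "C * ennpowr (primitive w0 (wmeas u0 E)) (1 / p0)"
  have level: "ennpowr (primitive w1 t) (1 / p1) * s \<le> ?B"
    if s: "0 < s" "s < \<infinity>" and t: "t < distr_fun u1 (maximal (indicator E)) s" for s t
  proof -
    let ?F = "{Q. is_cube Q \<and> s < emeasure lebesgue (E \<inter> Q) / emeasure lebesgue Q}"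
    \<comment> \<open>Cubes are open, so a countable subfamily has the same union; continuity from
      below needs countability.\<close>
    obtain F where F: "F \<subseteq> ?F" "countable F" "\<Union>F = \<Union>?F"
      by (rule Lindelof[of ?F]) (auto intro: open_cube)
    have u1m: "u1 \<in> borel_measurable lebesgue" using u1 by (simp add: weight_def)
    have Fm: "F \<subseteq> sets lebesgue" using F(1) sets_cube by auto
    have "t < wmeas u1 (\<Union>F)"
      using t unfolding distr_fun_def superlevel_maximal_indicator[OF E] F(3) .
    then have "t < emeasure (density lebesgue (\<lambda>x. ennreal (u1 x))) (\<Union>F)"
      using wmeas_eq_emeasure[OF u1m] Fm F(2) by (metis sets.countable_Union)
    then obtain G where G: "finite G" "G \<subseteq> F" "t < emeasure (density lebesgue (\<lambda>x. ennreal (u1 x))) (\<Union>G)"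
      using less_emeasure_Union_finite_subfamily[OF F(2)] Fm by (metis sets_density)
    then have tG: "t < wmeas u1 (\<Union>G)"
      using wmeas_eq_emeasure[OF u1m] Fm by (metis order.trans sets.finite_Union)
    have "G \<noteq> {}" using G(3) by auto
    \<comment> \<open>Numbers the finite family from \<open>1\<close>, to match the indexing in
      \<open>cover\<close>.\<close>
    obtain Q where Q: "bij_betw Q {1..card G} G"
      using ex_bij_betw_nat_finite_1[OF G(1)] by blast
    define J where "J = card G"
    have J: "1 \<le> J" using \<open>G \<noteq> {}\<close> G(1) by (simp add: J_def Suc_le_eq card_gt_0_iff)
    have QJ: "Q ` {1..J} = G" using Q by (simp add: bij_betw_def J_def)
    have cube: "is_cube (Q j)" and dens: "s < emeasure lebesgue (E \<inter> Q j) / emeasure lebesgue (Q j)"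
      if "j \<in> {1..J}" for j
    proof -
      have "Q j \<in> ?F" using that QJ G(2) F(1) by blast
      then show "is_cube (Q j)" "s < emeasure lebesgue (E \<inter> Q j) / emeasure lebesgue (Q j)" by auto
    qed
    define R where "R = Max ((\<lambda>j. emeasure lebesgue (Q j) / emeasure lebesgue (E \<inter> Q j)) ` {1..J})"
    \<comment> \<open>Each selected cube satisfies \<open>|E \<inter> Q j| > s |Q j|\<close>, so
      every quotient in the maximum is at most \<open>1 / s\<close>.\<close>
    have "R \<le> 1 / s"
      unfolding R_def
    proof (rule Max.boundedI)
      fix q assume "q \<in> (\<lambda>j. emeasure lebesgue (Q j) / emeasure lebesgue (E \<inter> Q j)) ` {1..J}"
      then obtain j where j: "j \<in> {1..J}"
        and q: "q = emeasure lebesgue (Q j) / emeasure lebesgue (E \<inter> Q j)" by blast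
      have "s * emeasure lebesgue (Q j) \<le> emeasure lebesgue (E \<inter> Q j)"
      proof -
        have "s * emeasure lebesgue (Q j)
            \<le> emeasure lebesgue (E \<inter> Q j) / emeasure lebesgue (Q j) * emeasure lebesgue (Q j)"
          using dens[OF j] by (intro mult_right_mono) auto
        also have "\<dots> = emeasure lebesgue (E \<inter> Q j)"
          using emeasure_cube_pos[OF cube[OF j]] emeasure_cube_less_top[OF cube[OF j]]
          by (simp add: ennreal_divide_times ennreal_divide_self)
        finally show ?thesis .
      qed
      then have "1 / s * (s * emeasure lebesgue (Q j)) \<le> 1 / s * emeasure lebesgue (E \<inter> Q j)"
        by (rule mult_left_mono) simp
      moreover have "1 / s * (s * emeasure lebesgue (Q j)) = emeasure lebesgue (Q j)"
        using ennreal_inverse_mult_self[OF s] by (simp only: mult.assoc[symmetric] mult_1)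
      ultimately show "q \<le> 1 / s"
        unfolding q by (intro ennreal_divide_leI) metis
    qed (use J in auto)
    let ?W0 = "ennpowr (primitive w0 (wmeas u0 (\<Union>j\<in>{1..J}. E \<inter> Q j))) (1 / p0)"
    have "1 / s < \<infinity>" using s by (auto simp: ennreal_divide_eq_top_iff less_top[symmetric])
    have "ennpowr (primitive w1 (wmeas u1 (\<Union>j\<in>{1..J}. Q j))) (1 / p1) / ?W0 \<le> C * R"
      unfolding R_def using J cube sets.Int[OF E sets_cube] by (intro cover) blast+
    also have "\<dots> \<le> C * (1 / s)" by (intro mult_left_mono \<open>R \<le> 1 / s\<close>) simp
    finally have quot: "ennpowr (primitive w1 (wmeas u1 (\<Union>G))) (1 / p1) / ?W0 \<le> C * (1 / s)"
      using QJ by simp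
    \<comment> \<open>Boundedness makes \<open>?W0\<close> finite; a quotient by infinity would be
      \<open>0\<close> and carry no information.\<close>
    have "bounded (\<Union>j\<in>{1..J}. E \<inter> Q j)"
      using bounded_Int bounded_cube[OF cube] by (intro bounded_UN) blast+
    then have "?W0 < \<infinity>"
      using wmeas_bounded_less_top[OF u0] w0 by (intro ennpowr_less_top) blast
    moreover have "C * (1 / s) < \<infinity>" using C \<open>1 / s < \<infinity>\<close> by (simp add: ennreal_mult_less_top)
    ultimately have "ennpowr (primitive w1 (wmeas u1 (\<Union>G))) (1 / p1) \<le> C * (1 / s) * ?W0"
      using ennreal_le_of_divide_le[OF quot] by blast
    \<comment> \<open>Only after clearing the denominator is the union enlarged to \<open>E\<close>,
      whose \<open>u0\<close>-mass may be infinite.\<close>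
    also have "\<dots> \<le> C * (1 / s) * ennpowr (primitive w0 (wmeas u0 E)) (1 / p0)"
      using p0 by (intro mult_left_mono ennpowr_mono primitive_mono wmeas_mono) auto
    finally have "ennpowr (primitive w1 (wmeas u1 (\<Union>G))) (1 / p1)
        \<le> C * (1 / s) * ennpowr (primitive w0 (wmeas u0 E)) (1 / p0)" .
    moreover have "ennpowr (primitive w1 t) (1 / p1) \<le> ennpowr (primitive w1 (wmeas u1 (\<Union>G))) (1 / p1)"
      using tG p1 by (intro ennpowr_mono primitive_mono) auto
    ultimately have "ennpowr (primitive w1 t) (1 / p1)
        \<le> C * (1 / s) * ennpowr (primitive w0 (wmeas u0 E)) (1 / p0)"
      by (rule order.trans[rotated])
    then have "ennpowr (primitive w1 t) (1 / p1) * s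
        \<le> C * (1 / s) * ennpowr (primitive w0 (wmeas u0 E)) (1 / p0) * s"
      by (rule mult_right_mono) simp
    also have "\<dots> = (1 / s * s) * ?B" by (simp only: mult_ac)
    also have "\<dots> = ?B" using ennreal_inverse_mult_self[OF s] by (simp only: mult_1)
    finally show ?thesis .
  qed
  show ?thesis
    unfolding weak_lorentz_norm_def lorentz_norm_indicator
  proof (rule SUP_least)
    fix t :: real
    let ?a = "ennpowr (primitive w1 (ennreal t)) (1 / p1)"
    let ?r = "rearrangement u1 (maximal (indicator E)) (ennreal t)"
    \<comment> \<open>The rearrangement is the supremum of the levels strictly below it. These are
      finite even if \<open>?r\<close> is infinite, and the positive ones satisfy the hypotheses of
      \<open>level\<close>; for \<open>?r = 0\<close> the supremum is empty and equals
      \<open>0\<close>.\<close>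
    have "?a * ?r = (SUP s\<in>{..<?r}. ?a * s)"
      by (cases "?r = 0") (simp_all add: SUP_mult_left_ennreal[symmetric])
    also have "\<dots> \<le> ?B"
    proof (rule SUP_least)
      fix s assume s: "s \<in> {..<?r}"
      show "?a * s \<le> ?B"
      proof (cases "s = 0")
        case False
        then have "0 < s" by (simp add: zero_less_iff_neq_zero)
        moreover have "s < \<infinity>" using s by (auto intro: less_le_trans)
        ultimately show ?thesis using s by (intro level less_distr_fun) auto
      qed simp
    qed
    finally show "?a * ?r \<le> ?B" .
  qed
qed

theorem theorem3p2p4:
  fixes u0 u1 :: "real ^ 'n \<Rightarrow> real" and w0 w1 :: "real \<Rightarrow> real" and p0 p1 :: real
  assumes "weight u0" and "weight u1"
    and "half_line_weight u0 w0" and "half_line_weight u1 w1"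
    and "0 < p0" and "0 < p1"
  shows "(\<exists>C::ennreal. C < \<infinity> \<and>
            (\<forall>E \<in> sets lebesgue.
               weak_lorentz_norm p1 u1 w1 (maximal (indicator E)) \<le> C * lorentz_norm p0 u0 w0 (indicator E)))
     \<longleftrightarrow>
         (\<exists>C::ennreal. C < \<infinity> \<and>
            (\<forall>(J::nat) (Q :: nat \<Rightarrow> (real ^ 'n) set) (E :: nat \<Rightarrow> (real ^ 'n) set).
               1 \<le> J \<longrightarrow>
               (\<forall>j\<in>{1..J}. is_cube (Q j) \<and> E j \<in> sets lebesgue \<and> E j \<subseteq> Q j) \<longrightarrow>
               ennpowr (primitive w1 (wmeas u1 (\<Union>j\<in>{1..J}. Q j))) (1 / p1) /
               ennpowr (primitive w0 (wmeas u0 (\<Union>j\<in>{1..J}. E j))) (1 / p0)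
               \<le> C * Max ((\<lambda>j. emeasure lebesgue (Q j) / emeasure lebesgue (E j)) ` {1..J})))"
    (is "(\<exists>C. _ \<and> ?weak C) \<longleftrightarrow> (\<exists>C. _ \<and> ?cover C)")
proof
  assume "\<exists>C::ennreal. C < \<infinity> \<and> ?weak C"
  then obtain C where C: "C < \<infinity>" "?weak C" by blast
  have "?cover (C + 1)"
    using assms C(2)
    by (intro allI impI covering_inequality_of_weak_type) (auto simp only: half_line_weight_def)
  then show "\<exists>C::ennreal. C < \<infinity> \<and> ?cover C" using C(1) by (intro exI[of _ "C + 1"]) simp
next
  assume "\<exists>C::ennreal. C < \<infinity> \<and> ?cover C"
  then obtain C where C: "C < \<infinity>" "?cover C" by blast
  have "?weak C"
    using assms C
    by (intro ballI weak_type_of_covering_inequality) (auto simp only: half_line_weight_def)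
  then show "\<exists>C::ennreal. C < \<infinity> \<and> ?weak C" using C(1) by blast
qed

end
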